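(* Let $v\ge 1$, let $\lambda=(\lambda_1,\dots,\lambda_v)$ with all $\lambda_k>0$, and let $X\sim\mathcal N_v(0,\operatorname{diag}(\lambda))$. Let $n\in\{1,\dots,v\}$ and $0<\rho\le 2\lambda_n$ (with no condition on the $\lambda_i$, $i\ne n$). Then $$\operatorname{var}\left(X_n^2\,|\,X\in\mathcal B_v(\rho)\right)\le 2\lambda_n\,\mathbb E\left[X_n^2\,|\,X\in\mathcal B_v(\rho)\right].$$
   Context: $\mathcal B_v(\rho)=\{x\in\mathbb R^v:\ x^{T}x<\rho\}$ is the centered Euclidean ball of square radius $\rho$. $\operatorname{var}(\cdot\,|\,X\in\mathcal B_v(\rho))$ and $\mathbb E[\,\cdot\,|\,X\in\mathcal B_v(\rho)]$ denote variance and expectation under the law of $X$ conditioned on the event $X\in\mathcal B_v(\rho)$. *)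

theory Defs
  imports "HOL-Probability.Probability"
begin

definition diag_matrix :: "real ^ 'v \<Rightarrow> real ^ 'v ^ 'v" where
  "diag_matrix d = (\<chi> i j. if i = j then d $ i else 0)"

text \<open>Density of the \<open>v\<close>-variate normal law with mean \<open>\<mu>\<close> and (positive definite)
  covariance matrix \<open>\<Sigma>\<close>, where \<open>v = CARD('v)\<close>.\<close>

definition mvn_density :: "real ^ 'v \<Rightarrow> real ^ 'v ^ 'v \<Rightarrow> real ^ 'v \<Rightarrow> real" where
  "mvn_density \<mu> \<Sigma> x =
     exp (- ((x - \<mu>) \<bullet> (matrix_inv \<Sigma> *v (x - \<mu>))) / 2) / sqrt ((2 * pi) ^ CARD('v) * det \<Sigma>)"

definition sq_ball :: "real \<Rightarrow> (real ^ 'v) set" where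
  "sq_ball \<rho> = {x. x \<bullet> x < \<rho>}"

text \<open>Expectation and variance with respect to the conditioned measure
  \<open>uniform_measure M A\<close>, that is, \<open>B \<mapsto> P(A \<inter> B) / P(A)\<close>.
  They are meaningful only if the event \<open>A\<close> has positive probability.\<close>

definition cexp :: "'a measure \<Rightarrow> ('a \<Rightarrow> real) \<Rightarrow> 'a set \<Rightarrow> real" where
  "cexp M Y A = (\<integral>\<omega>. Y \<omega> \<partial>uniform_measure M A)"

definition cvar :: "'a measure \<Rightarrow> ('a \<Rightarrow> real) \<Rightarrow> 'a set \<Rightarrow> real" where
  "cvar M Y A = (\<integral>\<omega>. (Y \<omega> - cexp M Y A)\<^sup>2 \<partial>uniform_measure M A)"

lemma mvn_density_diag:
  fixes l :: "real ^ 'v"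
  assumes pos: "\<And>k. 0 < l $ k"
  shows "mvn_density 0 (diag_matrix l) x = (\<Prod>k\<in>UNIV. normal_density 0 (sqrt (l $ k)) (x $ k))"
proof -
  let ?D = "diag_matrix l" and ?E = "diag_matrix (\<chi> k. 1 / l $ k)"
  have nz: "l $ k \<noteq> 0" for k
    using pos[of k] by simp
  have "(\<Sum>k\<in>UNIV. (if i = k then a $ i else 0) * (if k = j then b $ k else 0))
      = (if i = j then a $ i * b $ i else 0)" for a b :: "real ^ 'v" and i j
  proof -
    have "(\<Sum>k\<in>UNIV. (if i = k then a $ i else 0) * (if k = j then b $ k else 0))
      = (\<Sum>k\<in>UNIV. if i = k then a $ i * (if i = j then b $ i else 0) else 0)"
      by (rule sum.cong) auto
    then show ?thesis by simp
  qed
  then have mult: "diag_matrix a ** diag_matrix b = diag_matrix (\<chi> k. a $ k * b $ k)"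
    for a b :: "real ^ 'v"
    by (simp add: diag_matrix_def matrix_matrix_mult_def vec_eq_iff)
  have DE: "?D ** ?E = mat 1" "?E ** ?D = mat 1"
    unfolding mult by (simp_all add: nz diag_matrix_def mat_def vec_eq_iff)
  then have "?D ** matrix_inv ?D = mat 1 \<and> matrix_inv ?D ** ?D = mat 1"
    unfolding matrix_inv_def by (intro someI_ex[of "\<lambda>A. ?D ** A = mat 1 \<and> A ** ?D = mat 1"]) blast
  then have inv: "matrix_inv ?D = ?E"
    by (metis DE(2) matrix_mul_assoc matrix_mul_lid matrix_mul_rid)
  have det: "det ?D = (\<Prod>k\<in>UNIV. l $ k)"
    by (subst det_diagonal) (auto simp: diag_matrix_def)
  have Ex: "(?E *v x) $ i = x $ i / l $ i" for i
  proof -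
    have "(?E *v x) $ i = (\<Sum>k\<in>UNIV. if i = k then x $ i / l $ i else 0)"
      unfolding diag_matrix_def matrix_vector_mult_def vec_lambda_beta
      by (rule sum.cong) auto
    then show ?thesis by simp
  qed
  have quad: "x \<bullet> (?E *v x) = (\<Sum>k\<in>UNIV. (x $ k)\<^sup>2 / l $ k)"
    by (simp add: Ex inner_vec_def power2_eq_square)
  have "- (\<Sum>k\<in>UNIV. (x $ k)\<^sup>2 / l $ k) / 2 = (\<Sum>k\<in>UNIV. - (x $ k)\<^sup>2 / (2 * l $ k))"
    by (simp add: sum_negf sum_divide_distrib mult.commute)
  then have num: "exp (- (x \<bullet> (?E *v x)) / 2) = (\<Prod>k\<in>UNIV. exp (- (x $ k)\<^sup>2 / (2 * l $ k)))"
    unfolding quad by (simp only: exp_sum finite)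
  have "(2 * pi) ^ CARD('v) * det ?D = (\<Prod>k\<in>UNIV. 2 * pi * l $ k)"
    unfolding det by (simp only: prod.distrib prod_constant power_mult_distrib)
  then have den: "sqrt ((2 * pi) ^ CARD('v) * det ?D) = (\<Prod>k\<in>UNIV. sqrt (2 * pi * l $ k))"
    using infinite_finite_induct[of "\<lambda>A. sqrt (\<Prod>k\<in>A. 2 * pi * l $ k) = (\<Prod>k\<in>A. sqrt (2 * pi * l $ k))" UNIV]
    by (simp add: real_sqrt_mult)
  have "mvn_density 0 ?D x =
      (\<Prod>k\<in>UNIV. exp (- (x $ k)\<^sup>2 / (2 * l $ k)) / sqrt (2 * pi * l $ k))"
    unfolding mvn_density_def inv diff_zero num den prod_dividef ..
  also have "\<dots> = (\<Prod>k\<in>UNIV. normal_density 0 (sqrt (l $ k)) (x $ k))"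
    by (rule prod.cong) (simp_all add: normal_density_def less_imp_le[OF pos])
  finally show ?thesis .
qed

end

theory Submission
  imports Defs
begin

text \<open>The inequality comes from the bounded range of \<open>X\<^sub>n\<^sup>2\<close> on the ball. On
  \<open>X \<in> sq_ball \<rho>\<close> one has \<open>0 \<le> X\<^sub>n\<^sup>2 \<le> X \<bullet> X < \<rho> \<le> 2 \<lambda>\<^sub>n\<close>, so \<open>X\<^sub>n\<^sup>4 \<le> 2 \<lambda>\<^sub>n X\<^sub>n\<^sup>2\<close>
  pointwise, and a variance never exceeds the second moment. The lemma \<open>cvar_le_bound_cexp\<close>
  carries out this argument for a bounded nonnegative variable.\<close>

text \<open>Integrating \<open>Y\<^sup>2 \<le> b Y\<close> bounds the second moment of \<open>Y\<close>, hence its variance. If \<open>A\<close> is a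
  null set, then \<open>uniform_measure M A\<close> is the zero measure and both sides vanish.\<close>

lemma cvar_le_bound_cexp:
  assumes "finite_measure M" and A: "A \<in> sets M" and Y: "Y \<in> borel_measurable M"
    and range: "\<And>\<omega>. \<omega> \<in> A \<Longrightarrow> 0 \<le> Y \<omega> \<and> Y \<omega> \<le> b"
  shows "cvar M Y A \<le> b * cexp M Y A"
proof -
  interpret M: finite_measure M by fact
  let ?N = "uniform_measure M A"
  have AE_A: "AE \<omega> in ?N. P \<omega>" if "\<And>\<omega>. \<omega> \<in> A \<Longrightarrow> P \<omega>" for P
    using that by (intro AE_uniform_measureI[OF A]) auto
  show ?thesis
  proof (cases "emeasure M A = 0")
    case True
    then have "AE \<omega> in M. \<omega> \<notin> A"
      using A by (intro AE_not_in) (auto simp: null_sets_def)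
    then have "AE \<omega> in ?N. P \<omega>" for P
      by (intro AE_uniform_measureI[OF A]) auto
    then have "(\<integral>\<omega>. f \<omega> \<partial>?N) = 0" for f :: "'a \<Rightarrow> real"
      by (intro integral_eq_zero_AE)
    then show ?thesis
      by (simp add: cvar_def cexp_def)
  next
    case False
    interpret N: prob_space ?N
      using False by (intro prob_space_uniform_measure) auto
    have YN [measurable]: "Y \<in> borel_measurable ?N"
      using Y by simp
    have int1: "integrable ?N Y"
      by (rule N.integrable_const_bound[where B = b, OF AE_A YN]) (use range in force)
    have square_le: "(Y \<omega>)\<^sup>2 \<le> b * Y \<omega>" if "\<omega> \<in> A" for \<omega>
      using range[OF that] by (simp add: power2_eq_square mult_right_mono)
    have int2: "integrable ?N (\<lambda>\<omega>. (Y \<omega>)\<^sup>2)"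
    proof (rule Bochner_Integration.integrable_bound)
      show "integrable ?N (\<lambda>\<omega>. b * Y \<omega>)"
        using int1 by simp
      show "AE \<omega> in ?N. norm ((Y \<omega>)\<^sup>2) \<le> norm (b * Y \<omega>)"
        using square_le by (intro AE_A) force
    qed measurable
    have "cvar M Y A = N.expectation (\<lambda>\<omega>. (Y \<omega>)\<^sup>2) - (N.expectation Y)\<^sup>2"
      unfolding cvar_def cexp_def by (rule N.variance_eq[OF int1 int2])
    also have "\<dots> \<le> N.expectation (\<lambda>\<omega>. (Y \<omega>)\<^sup>2)"
      by simp
    also have "\<dots> \<le> N.expectation (\<lambda>\<omega>. b * Y \<omega>)"
      using int1 int2 square_le by (intro integral_mono_AE AE_A) auto
    also have "\<dots> = b * cexp M Y A"
      by (simp add: cexp_def)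
    finally show ?thesis .
  qed
qed

theorem mainTheorem2:
  fixes M :: "'a measure"
    and X :: "'a \<Rightarrow> real ^ 'v"
    and lam :: "real ^ 'v"
    and n :: 'v
    and \<rho> :: real
  assumes "prob_space M"
    and "\<And>k. 0 < lam $ k"
    and "distributed M lborel X (\<lambda>x. ennreal (mvn_density 0 (diag_matrix lam) x))"
    and "0 < \<rho>" and "\<rho> \<le> 2 * lam $ n"
  shows "cvar M (\<lambda>\<omega>. (X \<omega> $ n)\<^sup>2) {\<omega> \<in> space M. X \<omega> \<in> sq_ball \<rho>}
       \<le> 2 * lam $ n * cexp M (\<lambda>\<omega>. (X \<omega> $ n)\<^sup>2) {\<omega> \<in> space M. X \<omega> \<in> sq_ball \<rho>}"
proof (rule cvar_le_bound_cexp)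
  show "finite_measure M"
    using assms(1) by (rule prob_space.finite_measure)
  have X [measurable]: "X \<in> borel_measurable M"
    using distributed_measurable[OF assms(3)] by simp
  show "{\<omega> \<in> space M. X \<omega> \<in> sq_ball \<rho>} \<in> sets M"
    unfolding sq_ball_def mem_Collect_eq by measurable
  have "(\<lambda>\<omega>. X \<omega> \<bullet> axis n 1) \<in> borel_measurable M"
    by measurable
  then show "(\<lambda>\<omega>. (X \<omega> $ n)\<^sup>2) \<in> borel_measurable M"
    by (simp add: inner_axis)
next
  fix \<omega>
  assume "\<omega> \<in> {\<omega> \<in> space M. X \<omega> \<in> sq_ball \<rho>}"
  then have ball: "X \<omega> \<bullet> X \<omega> < \<rho>"
    by (simp add: sq_ball_def)
  have "(X \<omega> $ n)\<^sup>2 \<le> (\<Sum>k\<in>UNIV. (X \<omega> $ k)\<^sup>2)"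
    by (rule member_le_sum) auto
  also have "\<dots> = X \<omega> \<bullet> X \<omega>"
    by (simp add: inner_vec_def power2_eq_square)
  finally show "0 \<le> (X \<omega> $ n)\<^sup>2 \<and> (X \<omega> $ n)\<^sup>2 \<le> 2 * lam $ n"
    using ball assms(5) by simp
qed

end
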